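(* For every $k \in \mathbb{N}$, the smallest positive period $P_k$ of $g_k$ is $$P_k = \prod_{p \text{ prime},\ p \leq k} p^{\varepsilon_p(k)}, \qquad \text{where } \varepsilon_p(k) = \begin{cases} 0 & \text{if } v_p(k+1) \geq \max_{1 \leq i \leq k} v_p(i), \\ \max_{1 \leq i \leq k} v_p(i) & \text{otherwise.} \end{cases}$$
   Context: $\mathbb{N}$ denotes the nonnegative integers and $\mathbb{N}^* = \mathbb{N} \setminus \{0\}$. For $k \in \mathbb{N}$, the function $g_k : \mathbb{N}^* \to \mathbb{N}^*$ is defined by $g_k(n) = \frac{n(n+1)\cdots(n+k)}{\mathrm{lcm}(n, n+1, \dots, n+k)}$. It is known that $g_k$ is periodic. $P_k$ denotes the exact (i.e. smallest positive) period of $g_k$: the least positive integer $T$ such that $g_k(n+T) = g_k(n)$ for all $n \in \mathbb{N}^*$. For a prime $p$, $v_p$ denotes the $p$-adic valuation. *)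

theory Defs
  imports "HOL-Computational_Algebra.Computational_Algebra"
begin

(* The natural-number division is exact for n > 0, see g_mult_Lcm below; g k 0 is a junk
   value that is_period never looks at. *)
definition g :: "nat \<Rightarrow> nat \<Rightarrow> nat" where
  "g k n = (\<Prod>i=0..k. n + i) div Lcm {n..n+k}"

definition is_period :: "(nat \<Rightarrow> nat) \<Rightarrow> nat \<Rightarrow> bool" where
  "is_period f T \<longleftrightarrow> T > 0 \<and> (\<forall>n>0. f (n + T) = f n)"

definition exact_period :: "(nat \<Rightarrow> nat) \<Rightarrow> nat" where
  "exact_period f = (LEAST T. is_period f T)"

abbreviation P :: "nat \<Rightarrow> nat" where
  "P k \<equiv> exact_period (g k)"

definition max_val :: "nat \<Rightarrow> nat \<Rightarrow> nat" where
  "max_val p k = Max ((\<lambda>i. multiplicity p i) ` {1..k})"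

definition eps :: "nat \<Rightarrow> nat \<Rightarrow> nat" where
  "eps p k = (if multiplicity p (k + 1) \<ge> max_val p k then 0 else max_val p k)"

lemma Lcm_step: "Lcm {n..n + Suc k} = lcm (n + Suc k) (Lcm {n..n+k})" for n k :: nat
proof -
  have "{n..n + Suc k} = insert (n + Suc k) {n..n+k}" by auto
  then show ?thesis by simp
qed

lemma Lcm_interval_pos: "n > 0 \<Longrightarrow> Lcm {n..n+k} > 0" for n k :: nat
  by (rule gr0I) (simp add: Lcm_0_iff)

lemma Lcm_dvd_prod: "Lcm {n..n+k} dvd (\<Prod>i=0..k. n + i)" for n k :: nat
proof (rule Lcm_least)
  fix m assume "m \<in> {n..n+k}"
  then have "m - n \<in> {0..k}" "m = n + (m - n)" by auto
  then show "m dvd (\<Prod>i=0..k. n + i)"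
    by (metis dvd_prodI finite_atLeastAtMost)
qed

lemma g_mult_Lcm: "g k n * Lcm {n..n+k} = (\<Prod>i=0..k. n + i)"
  unfolding g_def using Lcm_dvd_prod by (rule dvd_div_mult_self)

lemma g_Suc:
  assumes "n > 0"
  shows "g (Suc k) n = g k n * gcd (n + Suc k) (Lcm {n..n+k})"
proof -
  let ?L = "Lcm {n..n+k}" and ?m = "n + Suc k"
  have "g (Suc k) n * lcm ?m ?L = g k n * ?L * ?m"
    using g_mult_Lcm[of "Suc k" n] g_mult_Lcm[of k n] by (simp only: Lcm_step) simp
  also have "\<dots> = (g k n * gcd ?m ?L) * lcm ?m ?L"
    using prod_gcd_lcm_nat[of ?m ?L] by (simp add: ac_simps)
  finally show ?thesis
    using Lcm_interval_pos[of n "Suc k"] assms unfolding Lcm_step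
    by (metis mult_right_cancel less_numeral_extra(3))
qed

lemma gcd_Lcm_shift:
  fixes n m T :: nat
  assumes "(\<And>j. 1 \<le> j \<Longrightarrow> j \<le> m \<Longrightarrow> j dvd T)" and "j \<le> k" "k < m"
  shows "gcd (n + m + T) (Lcm {n+T..n+T+j}) = gcd (n + m) (Lcm {n..n+j})"
  using assms(2)
proof (induction j)
  have "gcd (a + d) a = gcd (a + T + d) (a + T)" if d: "1 \<le> d" "d \<le> m" for a d :: nat
  proof -
    obtain q where "T = d * q" using assms(1)[OF d] by (auto elim: dvdE)
    then have "gcd d (a + T) = gcd d a"
      by (metis add.commute gcd_add_mult mult.commute)
    then show ?thesis by (metis add.commute gcd.commute gcd_add1)
  qed
  note key = this
  {
    case 0
    show ?case using key[of m n] assms(3) by (simp add: ac_simps)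
  next
    case (Suc j)
    have "gcd (n + m + T) (n + T + Suc j) = gcd (n + m) (n + Suc j)"
      using key[of "m - Suc j" "n + Suc j"] Suc.prems assms(3) by (simp add: ac_simps)
    then show ?case
      unfolding Lcm_step gcd_lcm_distrib using Suc by simp
  }
qed

lemma g_shift:
  assumes "\<And>j. 1 \<le> j \<Longrightarrow> j \<le> k \<Longrightarrow> j dvd T" "n > 0"
  shows "g k (n + T) = g k n"
  using assms(1)
proof (induction k)
  case 0
  then show ?case using assms(2) by (simp add: g_def)
next
  case (Suc k)
  then show ?case
    using gcd_Lcm_shift[of "Suc k" T k k n] assms(2) by (simp add: g_Suc ac_simps)
qed

lemma g_periodic: "is_period (g k) (fact k)"
  unfolding is_period_def using g_shift[of k "fact k"] dvd_fact by simp

end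

theory Submission
  imports Defs
begin

text \<open>
  Since \<open>gcd m (m - j) = gcd m j\<close>, adjoining a term on the right or on the left of the window
  multiplies \<open>g\<close> by a gcd with \<open>Lcm {1..k+1}\<close>. Hence \<open>g k n\<close> is the product of
  \<open>gcd (n + i) (Lcm {1..i})\<close>, and
  \<open>g k (n + 1) * gcd n M = g k n * gcd (n + k + 1) M\<close> with \<open>M = Lcm {1..k+1}\<close>.
  Everything is then read off prime by prime: with \<open>a = max_val p k\<close>, the valuation of \<open>g k n\<close>
  depends only on \<open>n\<close> modulo \<open>p ^ a\<close> and is constant if \<open>p ^ a\<close> divides \<open>k + 1\<close>; otherwise the
  relation above, taken at \<open>n = p ^ a\<close> and at a translate of it by a period of valuation
  \<open>a - 1\<close>, gives a contradiction.
\<close>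

section \<open>Extending the window of factors by one term\<close>

lemma gcd_Lcm_image:
  fixes m :: nat
  assumes "finite A"
  shows "gcd m (Lcm A) = (if A = {} then 1 else Lcm (gcd m ` A))"
  using assms
proof (induction A rule: finite_induct)
  case (insert x A)
  then show ?case
    by (cases "A = {}") (simp_all add: gcd_lcm_distrib)
qed simp

lemma gcd_Lcm_right:
  fixes n k :: nat
  shows "gcd (n + Suc k) (Lcm {n..n+k}) = gcd (n + Suc k) (Lcm {1..Suc k})"
proof -
  let ?m = "n + Suc k"
  have gcd_sub: "gcd ?m (?m - j) = gcd ?m j" if "j \<le> ?m" for j
    by (metis gcd.commute gcd_diff2_nat that)
  have "(\<lambda>j. ?m - j) ` {1..Suc k} = {n..n+k}"
  proof (intro equalityI subsetI)
    fix x assume "x \<in> {n..n+k}"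
    then have "x = ?m - (?m - x)" "?m - x \<in> {1..Suc k}" by auto
    then show "x \<in> (\<lambda>j. ?m - j) ` {1..Suc k}" by blast
  qed auto
  then have "gcd ?m ` {n..n+k} = (\<lambda>j. gcd ?m (?m - j)) ` {1..Suc k}"
    by (metis image_image)
  also have "\<dots> = gcd ?m ` {1..Suc k}"
    by (intro image_cong refl gcd_sub) simp
  finally show ?thesis
    by (simp add: gcd_Lcm_image)
qed

lemma gcd_Lcm_left:
  fixes n k :: nat
  shows "gcd n (Lcm {n + 1..n + 1 + k}) = gcd n (Lcm {1..Suc k})"
proof -
  have "{n + 1..n + 1 + k} = (\<lambda>j. n + j) ` {1..Suc k}"
    by simp
  then have "gcd n ` {n + 1..n + 1 + k} = (\<lambda>j. gcd n (n + j)) ` {1..Suc k}"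
    by (metis image_image)
  also have "\<dots> = gcd n ` {1..Suc k}"
    by (intro image_cong refl) simp
  finally show ?thesis
    by (simp add: gcd_Lcm_image)
qed

lemma g_Suc_right:
  assumes "n > 0"
  shows "g (Suc k) n = g k n * gcd (n + Suc k) (Lcm {1..Suc k})"
  using g_Suc[OF assms] by (simp only: gcd_Lcm_right)

lemma g_Suc_left:
  assumes "n > 0"
  shows "g (Suc k) n = g k (n + 1) * gcd n (Lcm {1..Suc k})"
proof -
  let ?L = "Lcm {n + 1..n + 1 + k}"
  have "{n..n + Suc k} = insert n {n + 1..n + 1 + k}" by auto
  then have L: "Lcm {n..n + Suc k} = lcm n ?L"
    by simp
  have "g (Suc k) n * lcm n ?L = (\<Prod>i=0..Suc k. n + i)"
    using g_mult_Lcm[of "Suc k" n] by (simp only: L)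
  also have "\<dots> = n * (\<Prod>i=0..k. n + 1 + i)"
    by (subst prod.atLeast0_atMost_Suc_shift) simp
  also have "\<dots> = g k (n + 1) * gcd n ?L * lcm n ?L"
    using g_mult_Lcm[of k "n + 1"] prod_gcd_lcm_nat[of n ?L] by (simp add: ac_simps)
  finally have "g (Suc k) n = g k (n + 1) * gcd n ?L"
    using Lcm_interval_pos[of "n + 1" k] assms
    by (metis mult_right_cancel lcm_eq_0_iff less_numeral_extra(3) add_gr_0)
  then show ?thesis by (simp only: gcd_Lcm_left)
qed

text \<open>Both sides are \<open>g (Suc k) n\<close>, obtained by adjoining \<open>n\<close> on the
  left of one window or \<open>n + Suc k\<close> on the right of the other. This is the recursion of
  \<open>g k\<close> in \<open>n\<close>.\<close>

lemma g_step:
  assumes "n > 0"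
  shows "g k (n + 1) * gcd n (Lcm {1..Suc k}) = g k n * gcd (n + Suc k) (Lcm {1..Suc k})"
  using g_Suc_left[OF assms] g_Suc_right[OF assms] by metis

lemma g_eq_prod:
  assumes "n > 0"
  shows "g k n = (\<Prod>i=1..k. gcd (n + i) (Lcm {1..i}))"
proof (induction k)
  case 0
  show ?case using assms by (simp add: g_def)
next
  case (Suc k)
  then show ?case by (simp only: g_Suc_right[OF assms]) simp
qed

lemma g_pos: "n > 0 \<Longrightarrow> g k n > 0"
  by (simp add: g_eq_prod prod_pos)

section \<open>Valuations of \<open>g\<close>, one prime at a time\<close>

lemma max_val_Suc:
  assumes "k \<ge> 1"
  shows "max_val p (Suc k) = max (multiplicity p (Suc k)) (max_val p k)"
proof -
  have "{1..Suc k} = insert (Suc k) {1..k}" by auto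
  then show ?thesis unfolding max_val_def using assms by simp
qed

lemma max_val_mono:
  assumes "1 \<le> i" "i \<le> k"
  shows "max_val p i \<le> max_val p k"
  unfolding max_val_def using assms by (intro Max_mono) auto

lemma multiplicity_Lcm:
  fixes p :: nat
  assumes "prime p" "k \<ge> 1"
  shows "multiplicity p (Lcm {1..k}) = max_val p k"
  using assms(2)
proof (induction k rule: dec_induct)
  case base
  show ?case by (simp add: max_val_def)
next
  case (step k)
  have "{1..Suc k} = insert (Suc k) {1..k}" by auto
  then have "Lcm {1..Suc k} = lcm (Suc k) (Lcm {1..k})" by simp
  moreover have "Lcm {1..k} \<noteq> 0" by (simp add: Lcm_0_iff)
  ultimately show ?case
    using step assms(1) by (simp add: max_val_Suc multiplicity_lcm)
qed

lemma multiplicity_gcd_Lcm: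
  fixes p :: nat
  assumes "prime p" "k \<ge> 1" "m > 0"
  shows "multiplicity p (gcd m (Lcm {1..k})) = min (multiplicity p m) (max_val p k)"
proof -
  have "Lcm {1..k} \<noteq> 0" by (simp add: Lcm_0_iff)
  then show ?thesis
    using assms multiplicity_Lcm[OF assms(1,2)] by (simp add: multiplicity_gcd)
qed

text \<open>For \<open>e \<le> b\<close>, divisibility by \<open>p ^ e\<close> does not change when
  a multiple of \<open>p ^ b\<close> is added, so a valuation truncated at \<open>b\<close> depends
  only on the residue modulo \<open>p ^ b\<close>.\<close>

lemma min_multiplicity_add:
  fixes p :: nat
  assumes "prime p" "p ^ b dvd T" "m > 0"
  shows "min (multiplicity p (m + T)) b = min (multiplicity p m) b"
proof -
  have not_unit: "\<not> is_unit p" using assms(1) by auto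
  \<comment> \<open>Two naturals with the same lower bounds are equal.\<close>
  have "e \<le> min (multiplicity p (m + T)) b \<longleftrightarrow> e \<le> min (multiplicity p m) b" for e
  proof (cases "e \<le> b")
    case True
    then have "p ^ e dvd T"
      using assms(2) by (meson dvd_trans le_imp_power_dvd)
    then have "p ^ e dvd m + T \<longleftrightarrow> p ^ e dvd m"
      by (rule dvd_add_left_iff)
    then show ?thesis
      using True assms(3) not_unit power_dvd_iff_le_multiplicity[of m p e]
        power_dvd_iff_le_multiplicity[of "m + T" p e] by simp
  qed simp
  then show ?thesis by (meson order.antisym order.refl)
qed

lemma multiplicity_g_step:
  fixes p :: nat
  assumes "prime p" "n > 0"
  shows "multiplicity p (g k (n + 1)) + min (multiplicity p n) (max_val p (Suc k)) =
         multiplicity p (g k n) + min (multiplicity p (n + Suc k)) (max_val p (Suc k))"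
proof -
  let ?M = "Lcm {1..Suc k}"
  have "multiplicity p (g k (n + 1) * gcd n ?M) = multiplicity p (g k n * gcd (n + Suc k) ?M)"
    using g_step[OF assms(2)] by simp
  moreover have "g k (n + 1) \<noteq> 0" "g k n \<noteq> 0"
    using g_pos[of "n + 1" k] g_pos[of n k] assms(2) by simp_all
  moreover have "gcd n ?M \<noteq> 0" "gcd (n + Suc k) ?M \<noteq> 0"
    using assms(2) by simp_all
  ultimately show ?thesis
    using assms multiplicity_gcd_Lcm[of p "Suc k" n] multiplicity_gcd_Lcm[of p "Suc k" "n + Suc k"]
    by (simp add: prime_elem_multiplicity_mult_distrib)
qed

lemma multiplicity_g_eq_sum:
  fixes p :: nat
  assumes "prime p" "n > 0"
  shows "multiplicity p (g k n) = (\<Sum>i=1..k. min (multiplicity p (n + i)) (max_val p i))"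
proof -
  have "multiplicity p (g k n) = (\<Sum>i=1..k. multiplicity p (gcd (n + i) (Lcm {1..i})))"
    unfolding g_eq_prod[OF assms(2)]
    using assms by (intro prime_elem_multiplicity_prod_distrib) auto
  also have "\<dots> = (\<Sum>i=1..k. min (multiplicity p (n + i)) (max_val p i))"
    using assms by (intro sum.cong refl multiplicity_gcd_Lcm) auto
  finally show ?thesis .
qed

lemma multiplicity_g_shift:
  fixes p :: nat
  assumes "prime p" "k \<ge> 1" "p ^ eps p k dvd T" "n > 0"
  shows "multiplicity p (g k (n + T)) = multiplicity p (g k n)"
proof (cases "multiplicity p (k + 1) \<ge> max_val p k")
  case True
  then have "max_val p (Suc k) = multiplicity p (Suc k)"
    using assms(2) by (simp add: max_val_Suc)
  then have "p ^ max_val p (Suc k) dvd Suc k"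
    by (metis multiplicity_dvd)
  \<comment> \<open>Adding \<open>Suc k\<close> does not affect the truncated valuation, so the two
    \<open>min\<close> terms of the recursion cancel and the valuation is constant in
    \<open>m\<close>.\<close>
  then have "multiplicity p (g k (m + 1)) = multiplicity p (g k m)" if "m > 0" for m
    using multiplicity_g_step[of p m k] min_multiplicity_add[of p _ "Suc k" m] assms(1) that
    by simp
  then show ?thesis
    using assms(4) by (induction T) simp_all
next
  case False
  then have "eps p k = max_val p k" by (simp add: eps_def)
  \<comment> \<open>The \<open>i\<close>-th summand of the valuation is truncated at
    \<open>max_val p i\<close>, which is at most \<open>max_val p k\<close>.\<close>
  then have "p ^ max_val p i dvd T" if "i \<in> {1..k}" for i
    using assms(3) max_val_mono[of i k p] that
    by (metis atLeastAtMost_iff dvd_trans le_imp_power_dvd)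
  then have "min (multiplicity p (n + T + i)) (max_val p i) =
      min (multiplicity p (n + i)) (max_val p i)" if "i \<in> {1..k}" for i
    using min_multiplicity_add[of p "max_val p i" T "n + i"] assms(1,4) that
    by (simp add: ac_simps)
  then show ?thesis
    using assms(1,4) by (simp add: multiplicity_g_eq_sum)
qed

section \<open>Prime powers that every period must contain\<close>

lemma is_period_mult:
  assumes "is_period f T" "c > 0"
  shows "is_period f (c * T)"
proof -
  have "f (n + c * T) = f n" if "n > 0" for n
  proof (induction c)
    case (Suc c)
    then show ?case
      using assms(1) that unfolding is_period_def
      by (metis add.assoc add.commute add_gr_0 mult_Suc)
  qed simp
  then show ?thesis using assms unfolding is_period_def by simp
qed

lemma power_eps_dvd_period:
  fixes p :: nat
  assumes "prime p" "k \<ge> 1" "is_period (g k) T"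
  shows "p ^ eps p k dvd T"
proof (rule ccontr)
  assume not_dvd: "\<not> p ^ eps p k dvd T"
  define a where "a = max_val p k"
  define v where "v = multiplicity p"
  have eps: "eps p k = a" and va: "v (Suc k) < a"
    using not_dvd by (auto simp: eps_def a_def v_def split: if_splits)
  have "T > 0" using assms(3) by (simp add: is_period_def)
  have not_unit: "\<not> is_unit p" and "p > 0"
    using assms(1) by (auto dest: prime_gt_0_nat)
  have vT: "v T < a"
    using not_dvd \<open>T > 0\<close> not_unit
    by (simp add: eps v_def power_dvd_iff_le_multiplicity)
  have max_val: "max_val p (Suc k) = a"
    using va assms(2) by (simp add: max_val_Suc a_def v_def)
  \<comment> \<open>The factor raises the valuation to exactly \<open>a - 1\<close>; no subtraction
    truncates, because \<open>v T < a\<close>.\<close>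
  define T' where "T' = p ^ (a - 1 - v T) * T"
  have T': "is_period (g k) T'"
    unfolding T'_def using assms(3) \<open>p > 0\<close> by (intro is_period_mult) auto
  then have "T' > 0" by (simp add: is_period_def)
  have vT': "v T' = a - 1"
    using assms(1) \<open>T > 0\<close> \<open>p > 0\<close> vT not_unit unfolding T'_def v_def
    by (simp add: prime_elem_multiplicity_mult_distrib multiplicity_same_power)
  define n where "n = p ^ a"
  have "n > 0" and vn: "v n = a"
    using \<open>p > 0\<close> not_unit by (simp_all add: n_def v_def multiplicity_same_power)
  \<comment> \<open>The valuations \<open>a\<close> and \<open>a - 1\<close> differ, as
    \<open>va\<close> forces \<open>a > 0\<close>, so the sum takes the smaller one.\<close>
  have vnT': "v (n + T') = a - 1"
    using multiplicity_sum_lt[of p T' n] vn vT' \<open>n > 0\<close> \<open>T' > 0\<close> va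
    by (simp add: v_def add.commute)
  have vnk: "v (n + Suc k) = v (Suc k)"
    using multiplicity_sum_lt[of p "Suc k" n] vn va \<open>n > 0\<close> 
    by (simp add: v_def add.commute)
  have step: "v (g k (m + 1)) + min (v m) a = v (g k m) + min (v (m + Suc k)) a"
    if "m > 0" for m
    using multiplicity_g_step[OF assms(1) that, of k] by (simp only: v_def max_val)
  have "g k (n + T') = g k n" "g k (n + T' + 1) = g k (n + 1)"
    using T' \<open>n > 0\<close> unfolding is_period_def
    by (metis, metis add.assoc add.commute add_gr_0)
  \<comment> \<open>Compare the recursion at \<open>n\<close> and at \<open>n + T'\<close>: the
    \<open>g\<close> terms agree by periodicity, while the left \<open>min\<close> drops from
    \<open>a\<close> to \<open>a - 1\<close>, so the right one must drop by one as well.\<close>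
  then have eq: "min (v (n + T' + Suc k)) a + 1 = v (Suc k)"
    using step[of n] step[of "n + T'"] \<open>n > 0\<close> vn vnT' vnk va by simp
  then have "v (n + T' + Suc k) < v (Suc k)" "v (Suc k) \<le> a - 1"
    using va by simp_all
  \<comment> \<open>Such a drop is impossible: \<open>p ^ v (Suc k)\<close> divides both
    \<open>n + T'\<close> and \<open>Suc k\<close>.\<close>
  moreover have "p ^ v (Suc k) dvd n + T' + Suc k"
  proof -
    have "p ^ v (Suc k) dvd n + T'"
      using \<open>v (Suc k) \<le> a - 1\<close> vnT' unfolding v_def by (metis multiplicity_dvd')
    then show ?thesis
      by (metis dvd_add multiplicity_dvd v_def)
  qed
  ultimately show False
    using not_unit unfolding v_def by (simp add: power_dvd_iff_le_multiplicity)
qed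

text \<open>Extends divisibility of the product by \<open>p ^ eps p k\<close> from primes up to
  \<open>k\<close> to all primes. With \<open>k = 0\<close>, \<open>max_val\<close> would be the
  \<open>Max\<close> of an empty set.\<close>

lemma eps_eq_0:
  assumes "k < p" "k \<ge> 1"
  shows "eps p k = 0"
proof -
  have "multiplicity p i = 0" if "i \<in> {1..k}" for i
    using assms that by (intro not_dvd_imp_multiplicity_0) (auto dest: dvd_imp_le)
  then have "(\<lambda>i. multiplicity p i) ` {1..k} = {0}"
    using assms(2) by force
  then show ?thesis by (simp add: eps_def max_val_def)
qed

theorem theorem3p2:
  fixes k :: nat
  shows "P k = (\<Prod>p | prime p \<and> p \<le> k. p ^ eps p k)"
proof (cases "k = 0")
  \<comment> \<open>\<open>g 0\<close> is constantly 1 and there is no prime to multiply over, so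
    both sides are 1.\<close>
  case True
  then have "{p. prime p \<and> p \<le> k} = {}" by auto
  then show ?thesis
    unfolding exact_period_def using True
    by (simp only: prod.empty)
       (rule Least_equality, simp_all add: is_period_def g_eq_prod)
next
  case False
  then have k: "k \<ge> 1" by simp
  let ?A = "{p. prime p \<and> p \<le> k}"
  let ?Q = "\<Prod>p\<in>?A. p ^ eps p k"
  have "finite ?A" by simp
  have "?Q > 0" by (intro prod_pos) (auto dest: prime_gt_0_nat)
  have dvd_Q: "p ^ eps p k dvd ?Q" if "prime p" for p
  proof (cases "p \<le> k")
    case True
    then show ?thesis using \<open>finite ?A\<close> that by (intro dvd_prodI) auto
  qed (use k in \<open>simp add: eps_eq_0\<close>)
  have "g k (n + ?Q) = g k n" if "n > 0" for n
  proof (rule multiplicity_eq_nat)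
    show "multiplicity p (g k (n + ?Q)) = multiplicity p (g k n)" if "prime p" for p
      using that k dvd_Q[OF that] \<open>n > 0\<close> by (rule multiplicity_g_shift)
  qed (simp_all add: g_pos that)
  then have "is_period (g k) ?Q"
    using \<open>?Q > 0\<close> by (simp add: is_period_def)
  \<comment> \<open>Minimality comes from the stronger fact that \<open>?Q\<close> divides every
    period.\<close>
  moreover have "?Q \<le> T" if "is_period (g k) T" for T
  proof -
    have "?Q dvd T"
    proof (rule multiplicity_le_imp_dvd)
      show "?Q \<noteq> 0" using \<open>?Q > 0\<close> by simp
      show "multiplicity p ?Q \<le> multiplicity p T" if "prime p" for p
        using multiplicity_prod_prime_powers[OF \<open>finite ?A\<close>, of p "\<lambda>p. eps p k"]
          power_eps_dvd_period[OF that k \<open>is_period (g k) T\<close>] that \<open>is_period (g k) T\<close>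
        by (auto simp: is_period_def intro!: multiplicity_geI)
    qed
    then show ?thesis using that by (auto simp: is_period_def dest: dvd_imp_le)
  qed
  ultimately show ?thesis
    unfolding exact_period_def by (rule Least_equality)
qed

end
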